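(* Let $X=\{X(s)\}_{s\ge0}$ be a real Lévy process with characteristic triplet $(\gamma,a,\nu)$ (with respect to the truncation $x\mathbf{1}_{\{|x|\le1\}}$). Assume that $\int_{|x|>1}e^{\rho|x|}\,\nu(dx)<\infty$ for some $\rho>0$, and fix $0<r<\rho$. Let $\mu_s\in H\mathbb{R}$ be the moment series $\mu_s(n)=\mathbb{E}[X(s)^n]$. Then $M=\{\mu_s\}_{s\ge0}$ is a norm-continuous $\boxplus^H_{-1}$-semigroup in $\mathcal{A}_{r,H}^{(-1)}$, and its infinitesimal generator is $$L_{r,H}^{(-1)}[M]=(\Phi_{-1}^H)^{-1}\circ M_{\eta_{\gamma,a,\nu}}\circ\Phi_{-1}^H,$$ where $M_{\eta_{\gamma,a,\nu}}F=\eta_{\gamma,a,\nu}F$ for $F\in\mathcal{A}_r$. Moreover, for $s\ge0$ and $|z|\le r$, $$\Phi_{-1}^H(\mu_s)(z)=\mathbb{E}[e^{-zX(s)}]=\exp\bigl(s\,\eta_{\gamma,a,\nu}(z)\bigr).$$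
   Context: $\mathbb{N}=\{0,1,2,\dots\}$. $H\mathbb{R}$ is the set of all maps $f:\mathbb{N}\to\mathbb{R}$. At parameter $-1$ the convolution is $(f\boxplus^H_{-1}g)(n)=\sum_{k=0}^n\binom nkf(k)g(n-k)$; $h_1(0)=1$, $h_1(m)=0$ for $m\ne0$; and $\Phi_{-1}^H(f)(z)=\sum_{n\ge0}\frac{(-1)^nf(n)}{n!}z^n$. $\mathcal{A}_{r,H}^{(-1)}=\{f\in H\mathbb{R}:\|f\|_{r,-1}:=\sum_{n\ge0}\frac{|f(n)|}{n!}r^n<\infty\}$; $\mathcal{A}_r=\{F(z)=\sum_{n\ge0}a_nz^n\ (a_n\in\mathbb{R}):\|F\|_r:=\sum_{n\ge0}|a_n|r^n<\infty\}$ with the Cauchy product; $\Phi_{-1}^H$ is a bijection $\mathcal{A}_{r,H}^{(-1)}\to\mathcal{A}_r$. A norm-continuous $\boxplus^H_{-1}$-semigroup in $\mathcal{A}_{r,H}^{(-1)}$ is a family $\{q_s\}_{s\ge0}\subset\mathcal{A}_{r,H}^{(-1)}$ with $q_0=h_1$, $q_{s+u}=q_s\boxplus^H_{-1}q_u$, and $\|q_s-h_1\|_{r,-1}\to0$ as $s\downarrow0$. Its infinitesimal generator $L_{r,H}^{(-1)}[\{q_s\}]$ is the operator $f\mapsto\lim_{s\downarrow0}\frac{f\boxplus^H_{-1}q_s-f}{s}$ on $\mathcal{A}_{r,H}^{(-1)}$ (limit in norm). Triplet convention: $\gamma\in\mathbb{R}$, $a\ge0$, $\nu$ a Lévy measure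 on $\mathbb{R}$ ($\nu(\{0\})=0$, $\int\min(1,x^2)\nu(dx)<\infty$), and $\mathbb{E}[e^{iuX(s)}]=\exp\bigl(s\bigl(i\gamma u-\tfrac a2u^2+\int_{\mathbb{R}}(e^{iux}-1-iux\mathbf{1}_{\{|x|\le1\}})\nu(dx)\bigr)\bigr)$. Define $$\eta_{\gamma,a,\nu}(z)=-\gamma z+\frac a2z^2+\int_{\mathbb{R}}\left(e^{-zx}-1+zx\mathbf{1}_{\{|x|\le1\}}\right)\nu(dx),\qquad |z|\le r,$$ identified with its power series expansion at $0$, which belongs to $\mathcal{A}_r$. *)

theory Defs
  imports "HOL-Probability.Probability" "HOL-Complex_Analysis.Complex_Analysis"
begin

definition hconv :: "(nat \<Rightarrow> real) \<Rightarrow> (nat \<Rightarrow> real) \<Rightarrow> nat \<Rightarrow> real" where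
  "hconv f g n = (\<Sum>k\<le>n. real (n choose k) * f k * g (n - k))"

definition hunit :: "nat \<Rightarrow> real" where
  "hunit m = (if m = 0 then 1 else 0)"

definition hnorm :: "real \<Rightarrow> (nat \<Rightarrow> real) \<Rightarrow> real" where
  "hnorm r f = (\<Sum>n. \<bar>f n\<bar> / fact n * r ^ n)"

definition HA :: "real \<Rightarrow> (nat \<Rightarrow> real) set" where
  "HA r = {f. summable (\<lambda>n. \<bar>f n\<bar> / fact n * r ^ n)}"

text \<open>
  Elements of the algebra \<open>PA r\<close> are represented by their coefficient series, i.e. as complex formal
  power series all of whose coefficients are real; the product of \<^typ>\<open>complex fps\<close> is the
  Cauchy product and \<^const>\<open>eval_fps\<close> is evaluation at a complex point.
\<close>
definition PA :: "real \<Rightarrow> complex fps set" where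
  "PA r = {F. (\<forall>n. fps_nth F n \<in> \<real>) \<and> summable (\<lambda>n. norm (fps_nth F n) * r ^ n)}"

definition hPhi :: "(nat \<Rightarrow> real) \<Rightarrow> complex fps" where
  "hPhi f = Abs_fps (\<lambda>n. of_real ((-1) ^ n * f n / fact n))"

lemma hPhi_bij: "bij_betw hPhi (HA r) (PA r)"
proof (rule bij_betw_imageI)
  show "inj_on hPhi (HA r)"
    by (auto simp: inj_on_def hPhi_def fps_eq_iff fun_eq_iff)
  show "hPhi ` HA r = PA r"
  proof (intro equalityI subsetI)
    fix F assume "F \<in> hPhi ` HA r"
    then show "F \<in> PA r"
      by (auto simp: hPhi_def HA_def PA_def abs_mult power_abs simp del: of_real_mult of_real_divide)
  next
    fix F assume F: "F \<in> PA r"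
    define f where "f n = (-1) ^ n * fact n * Re (fps_nth F n)" for n
    have re: "fps_nth F n = of_real (Re (fps_nth F n))" for n
      using F by (simp add: PA_def complex_is_Real_iff complex_eq_iff)
    have eq: "hPhi f = F"
      by (subst fps_eq_iff, intro allI, subst re)
         (simp add: hPhi_def f_def flip: mult.assoc power_mult_distrib)
    have nm: "\<bar>f n\<bar> / fact n = norm (fps_nth F n)" for n
      by (subst re, subst norm_of_real) (simp add: f_def abs_mult power_abs)
    have "f \<in> HA r"
      using F unfolding HA_def PA_def mem_Collect_eq nm by (rule conjunct2)
    with eq show "F \<in> hPhi ` HA r" by blast
  qed
qed

text \<open>
  Limits in \<open>HA r\<close> with respect to \<open>hnorm r\<close>.  Membership is demanded explicitly because
  \<open>hnorm r\<close> is a junk value outside \<open>HA r\<close>.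
\<close>
definition hlim :: "real \<Rightarrow> ('b \<Rightarrow> nat \<Rightarrow> real) \<Rightarrow> (nat \<Rightarrow> real) \<Rightarrow> 'b filter \<Rightarrow> bool" where
  "hlim r g l F \<longleftrightarrow> l \<in> HA r \<and> (\<forall>\<^sub>F s in F. g s \<in> HA r) \<and>
     ((\<lambda>s. hnorm r (\<lambda>n. g s n - l n)) \<longlongrightarrow> 0) F"

definition norm_continuous_hsemigroup :: "real \<Rightarrow> (real \<Rightarrow> nat \<Rightarrow> real) \<Rightarrow> bool" where
  "norm_continuous_hsemigroup r q \<longleftrightarrow>
     (\<forall>s\<ge>0. q s \<in> HA r) \<and> q 0 = hunit \<and>
     (\<forall>s\<ge>0. \<forall>u\<ge>0. q (s + u) = hconv (q s) (q u)) \<and>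
     hlim r q hunit (at_right 0)"

text \<open>
  \<open>L\<close> is the infinitesimal generator of \<open>q\<close>, as an operator on all of \<open>HA r\<close>: the defining limit
  exists for every \<open>f\<close> in \<open>HA r\<close> and has the value \<open>L f\<close>.
\<close>
definition has_hgenerator ::
    "real \<Rightarrow> (real \<Rightarrow> nat \<Rightarrow> real) \<Rightarrow> ((nat \<Rightarrow> real) \<Rightarrow> nat \<Rightarrow> real) \<Rightarrow> bool" where
  "has_hgenerator r q L \<longleftrightarrow>
     (\<forall>f\<in>HA r. hlim r (\<lambda>s n. (hconv f (q s) n - f n) / s) (L f) (at_right 0))"

text \<open>
  Path regularity is not part of the definition: a process with cadlag paths is a special case.
\<close>
definition levy_process :: "'a measure \<Rightarrow> (real \<Rightarrow> 'a \<Rightarrow> real) \<Rightarrow> bool" where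
  "levy_process P X \<longleftrightarrow>
     prob_space P \<and>
     (\<forall>t\<ge>0. X t \<in> borel_measurable P) \<and>
     (AE \<omega> in P. X 0 \<omega> = 0) \<and>
     (\<forall>(n::nat) t. 0 \<le> t 0 \<and> (\<forall>i<n. t i \<le> t (Suc i)) \<longrightarrow>
        prob_space.indep_vars P (\<lambda>_. borel) (\<lambda>i \<omega>. X (t (Suc i)) \<omega> - X (t i) \<omega>) {..<n}) \<and>
     (\<forall>s\<ge>0. \<forall>t\<ge>0. distr P borel (\<lambda>\<omega>. X (s + t) \<omega> - X s \<omega>) = distr P borel (X t)) \<and>
     (\<forall>s\<ge>0. \<forall>\<epsilon>>0.
        ((\<lambda>t. measure P {\<omega> \<in> space P. \<bar>X t \<omega> - X s \<omega>\<bar> > \<epsilon>}) \<longlongrightarrow> 0) (at s within {0..}))"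

definition levy_measure :: "real measure \<Rightarrow> bool" where
  "levy_measure \<nu> \<longleftrightarrow> sets \<nu> = sets borel \<and> emeasure \<nu> {0} = 0 \<and>
     (\<integral>\<^sup>+ x. ennreal (min 1 (x\<^sup>2)) \<partial>\<nu>) < \<infinity>"

definition levy_symbol :: "real \<Rightarrow> real \<Rightarrow> real measure \<Rightarrow> real \<Rightarrow> complex" where
  "levy_symbol \<gamma> a \<nu> u =
     \<i> * of_real (\<gamma> * u) - of_real (a / 2 * u\<^sup>2) +
     (\<integral> x. (exp (\<i> * of_real (u * x)) - 1
            - \<i> * of_real (u * x * indicator {x. \<bar>x\<bar> \<le> 1} x)) \<partial>\<nu>)"

definition characteristic_triplet ::
    "'a measure \<Rightarrow> (real \<Rightarrow> 'a \<Rightarrow> real) \<Rightarrow> real \<Rightarrow> real \<Rightarrow> real measure \<Rightarrow> bool" where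
  "characteristic_triplet P X \<gamma> a \<nu> \<longleftrightarrow> a \<ge> 0 \<and> levy_measure \<nu> \<and>
     (\<forall>s\<ge>0. \<forall>u. prob_space.expectation P (\<lambda>\<omega>. exp (\<i> * of_real (u * X s \<omega>))) =
        exp (of_real s * levy_symbol \<gamma> a \<nu> u))"

definition moment_series :: "'a measure \<Rightarrow> (real \<Rightarrow> 'a \<Rightarrow> real) \<Rightarrow> real \<Rightarrow> nat \<Rightarrow> real" where
  "moment_series P X s n = prob_space.expectation P (\<lambda>\<omega>. X s \<omega> ^ n)"

definition levy_eta :: "real \<Rightarrow> real \<Rightarrow> real measure \<Rightarrow> complex \<Rightarrow> complex" where
  "levy_eta \<gamma> a \<nu> z =
     - of_real \<gamma> * z + of_real (a / 2) * z\<^sup>2 +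
     (\<integral> x. (exp (- z * of_real x) - 1
            + z * of_real (x * indicator {x. \<bar>x\<bar> \<le> 1} x)) \<partial>\<nu>)"

end

theory Submission
  imports Defs
begin

text \<open>
  The exponential \<open>\<nu>\<close>-moment makes \<open>\<eta>\<close> a power series converging for \<open>|z| \<le> \<rho>\<close>, so the characteristic
  function of \<open>X s\<close> coincides near \<open>0\<close> with the function \<open>w \<mapsto> exp (s \<eta>(-iw))\<close>, holomorphic on the disc
  of radius \<open>\<rho>\<close>.  Fatou's lemma applied to symmetric second difference quotients of the characteristic
  function yields all even moments as derivatives at \<open>0\<close>; Cauchy's estimate bounds them and gives
  \<open>E exp (t |X s|) < \<infinity>\<close> for \<open>t < \<rho>\<close>.  The Laplace transform is then holomorphic and equals
  \<open>exp (s \<eta>)\<close> by the identity theorem, which turns the convolution semigroup into a multiplicative one.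
  Since the weighted \<open>l\<^sup>1\<close> norm at radius \<open>r\<close> is dominated by the supremum norm on a larger circle, the
  generator follows from \<open>(exp (s \<eta>) - 1) / s - \<eta> = O(s)\<close>, uniformly on that circle.
\<close>

section \<open>Exponential moments from a holomorphic characteristic function\<close>

text \<open>Taylor's formula of order two has a cubic remainder, uniform on a closed disc around
  \<open>u\<close>. The linear terms cancel between \<open>u + h\<close> and \<open>u - h\<close>,
  and the two remainders stay negligible after division by \<open>h^2\<close>.\<close>

lemma second_difference_tendsto:
  fixes f :: "complex \<Rightarrow> complex"
  assumes f: "f holomorphic_on S" and S: "open S" "u \<in> S"
  shows "((\<lambda>h. (f (u + h) + f (u - h) - 2 * f u) / h\<^sup>2) \<longlongrightarrow> deriv (deriv f) u) (at 0)"
proof -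
  obtain d where d: "d > 0" "cball u d \<subseteq> S"
    using S open_contains_cball by blast
  have hol: "(deriv ^^ n) f holomorphic_on S" for n
    using f S by (intro holomorphic_higher_deriv)
  have "compact ((deriv ^^ 3) f ` cball u d)"
    using hol[of 3] d by (intro compact_continuous_image holomorphic_on_imp_continuous_on)
      (auto intro: holomorphic_on_subset)
  then obtain B where B: "\<And>z. z \<in> cball u d \<Longrightarrow> norm ((deriv ^^ 3) f z) \<le> B"
    by (metis bounded_iff compact_imp_bounded imageI)
  have taylor: "norm (f z - (f u + deriv f u * (z - u) + deriv (deriv f) u * (z - u)\<^sup>2 / 2))
      \<le> B * norm (z - u) ^ 3 / 2" if z: "z \<in> cball u d" for z
  proof -
    have "norm ((deriv ^^ 0) f z - (\<Sum>i\<le>2. (deriv ^^ i) f u * (z - u) ^ i / fact i))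
        \<le> B * norm (z - u) ^ Suc 2 / fact 2"
    proof (rule field_Taylor[of "cball u d"])
      fix i x assume "x \<in> cball u d"
      then have "x \<in> S" using d by auto
      then show "((deriv ^^ i) f has_field_derivative (deriv ^^ Suc i) f x) (at x within cball u d)"
        using hol[of i] S holomorphic_derivI by fastforce
    qed (use B z d in \<open>auto simp: eval_nat_numeral\<close>)
    then show ?thesis by (simp add: eval_nat_numeral algebra_simps)
  qed
  show ?thesis
  proof (rule LIM_I)
    fix e :: real assume e: "e > 0"
    have B0: "B \<ge> 0" using B[of u] d by (meson centre_in_cball less_imp_le norm_ge_zero order_trans)
    show "\<exists>s>0. \<forall>h. h \<noteq> 0 \<and> norm (h - 0) < s \<longrightarrow>
      norm ((f (u + h) + f (u - h) - 2 * f u) / h\<^sup>2 - deriv (deriv f) u) < e"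
    \<comment> \<open>\<open>d\<close> keeps \<open>u + h\<close> and \<open>u - h\<close> in the
      disc where \<open>taylor\<close> holds; \<open>B + 1\<close> replaces \<open>B\<close> so that
      the divisor is positive even for \<open>B = 0\<close>.\<close>
    proof (intro exI[of _ "min d (e / (B + 1))"] conjI allI impI)
      fix h :: complex assume h: "h \<noteq> 0 \<and> norm (h - 0) < min d (e / (B + 1))"
      let ?R = "\<lambda>z. f z - (f u + deriv f u * (z - u) + deriv (deriv f) u * (z - u)\<^sup>2 / 2)"
      have "(f (u + h) + f (u - h) - 2 * f u) / h\<^sup>2 - deriv (deriv f) u =
          (?R (u + h) + ?R (u - h)) / h\<^sup>2"
        using h by (simp add: field_simps)
      also have "norm \<dots> \<le> (B * norm h ^ 3 / 2 + B * norm h ^ 3 / 2) / (norm h)\<^sup>2"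
      proof -
        have "norm (?R (u + h)) \<le> B * norm h ^ 3 / 2" "norm (?R (u - h)) \<le> B * norm h ^ 3 / 2"
          using taylor[of "u + h"] taylor[of "u - h"] h by (simp_all add: dist_norm)
        then show ?thesis unfolding norm_divide norm_power
          by (intro divide_right_mono order_trans[OF norm_triangle_ineq] add_mono) simp_all
      qed
      also have "\<dots> = B * norm h" using h by (simp add: field_simps power2_eq_square power3_eq_cube)
      also have "\<dots> \<le> (B + 1) * norm h" by (simp add: algebra_simps)
      also have "\<dots> < e" using h B0 by (simp add: field_simps)
      finally show "norm ((f (u + h) + f (u - h) - 2 * f u) / h\<^sup>2 - deriv (deriv f) u) < e" .
    qed (use d e B0 in auto)
  qed
qed

text \<open>The quotient is a phase times the nonpositive real number
  \<open>- (2 - 2 * cos (h * x)) / h^2\<close>. The bound is the majorant for dominated convergence;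
  at frequency 0 the phase is 1, and the sign makes Fatou's lemma applicable.\<close>

lemma norm_second_difference_cis_le:
  fixes h u x :: real
  assumes "h \<noteq> 0"
  defines "D \<equiv> \<lambda>u. (exp (\<i> * of_real ((u + h) * x)) + exp (\<i> * of_real ((u - h) * x))
      - 2 * exp (\<i> * of_real (u * x))) / (complex_of_real h)\<^sup>2"
  shows "norm (D u) \<le> x\<^sup>2" and "D 0 = - of_real (norm (D 0))"
proof -
  have D: "D u = exp (\<i> * of_real (u * x)) * of_real (- ((2 - 2 * cos (h * x)) / h\<^sup>2))" for u
  proof -
    have "exp (\<i> * of_real ((u + h) * x)) + exp (\<i> * of_real ((u - h) * x))
      - 2 * exp (\<i> * of_real (u * x)) = exp (\<i> * of_real (u * x)) *
        (exp (\<i> * of_real (h * x)) + exp (- (\<i> * of_real (h * x))) - 2)"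
      by (simp add: algebra_simps exp_add exp_diff exp_minus field_simps)
    also have "exp (\<i> * of_real (h * x)) + exp (- (\<i> * of_real (h * x))) = 2 * of_real (cos (h * x))"
      unfolding cos_of_real[symmetric] by (simp add: cos_exp_eq)
    finally show ?thesis by (simp add: D_def diff_divide_distrib algebra_simps)
  qed
  have c: "0 \<le> (2 - 2 * cos (h * x)) / h\<^sup>2" by simp
  \<comment> \<open>The half-angle form reduces the bound to \<open>|sin y| <= |y|\<close>, which
    makes it independent of \<open>h\<close>.\<close>
  have "2 - 2 * cos (h * x) = 4 * (sin (h * x / 2))\<^sup>2"
    using cos_double_sin[of "h * x / 2"] by simp
  also have "\<dots> \<le> 4 * (h * x / 2)\<^sup>2"
    using abs_sin_x_le_abs_x[of "h * x / 2"] by (simp only: abs_le_square_iff mult_le_cancel_left) simp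
  finally have "(2 - 2 * cos (h * x)) / h\<^sup>2 \<le> x\<^sup>2"
    using assms(1) by (simp add: divide_simps power_mult_distrib mult.commute)
  then show "norm (D u) \<le> x\<^sup>2"
    unfolding D norm_mult norm_of_real using c by simp
  show "D 0 = - of_real (norm (D 0))"
    unfolding D norm_mult norm_of_real using c by (simp add: abs_of_nonneg)
qed

text \<open>Fatou's lemma at frequency 0 gives integrability without presupposing it; then
  \<open>w * X^2\<close> dominates the difference quotients and yields the formula at every
  frequency below \<rho>. The weight \<open>w\<close> makes the lemma iterable, with even powers of
  \<open>X\<close> as weights.\<close>

lemma second_moment_of_holomorphic_transform:
  fixes w X :: "'a \<Rightarrow> real" and f :: "complex \<Rightarrow> complex"
  assumes [measurable]: "X \<in> borel_measurable M" and w: "integrable M w" "\<And>x. 0 \<le> w x"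
    and f: "f holomorphic_on ball 0 \<rho>" and \<rho>: "\<rho> > 0"
    and tr: "\<And>u. \<bar>u\<bar> < \<rho> \<Longrightarrow>
      (\<integral>x. of_real (w x) * exp (\<i> * of_real (u * X x)) \<partial>M) = f (of_real u)"
  shows "integrable M (\<lambda>x. w x * (X x)\<^sup>2)"
    and "\<And>u. \<bar>u\<bar> < \<rho> \<Longrightarrow>
      (\<integral>x. of_real (w x * (X x)\<^sup>2) * exp (\<i> * of_real (u * X x)) \<partial>M) = - deriv (deriv f) (of_real u)"
proof -
  have [measurable]: "w \<in> borel_measurable M" using w by auto
  define e where "e u x = exp (\<i> * complex_of_real (u * X x))" for u x
  have [measurable]: "e u \<in> borel_measurable M" for u unfolding e_def by measurable
  have nrm [simp]: "norm (e u x) = 1" for u x by (simp add: e_def)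
  define D where "D h u x = (e (u + h) x + e (u - h) x - 2 * e u x) / (complex_of_real h)\<^sup>2" for h u x
  have [measurable]: "D h u \<in> borel_measurable M" for h u unfolding D_def by measurable
  have int: "integrable M (\<lambda>x. complex_of_real (w x) * e u x)" for u
    by (rule Bochner_Integration.integrable_bound[OF w(1)]) (auto simp: norm_mult)
  have D_le: "norm (D h u x) \<le> (X x)\<^sup>2" and D_0: "D h 0 x = - of_real (norm (D h 0 x))"
    if "h \<noteq> 0" for h u x
    using norm_second_difference_cis_le[OF that, where x = "X x"] unfolding D_def e_def by auto
  \<comment> \<open>Both limit theorems for integrals are applied along sequences. Steps of at most
    half the distance from \<open>|u|\<close> to \<rho> keep all nodes where the transform is
    known.\<close>
  have seq: "\<exists>h. (\<forall>n. h n \<noteq> 0 \<and> \<bar>u + h n\<bar> < \<rho> \<and> \<bar>u - h n\<bar> < \<rho>) \<and> h \<longlonglongrightarrow> 0"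
    if "\<bar>u\<bar> < \<rho>" for u :: real
  proof -
    define h where "h n = (\<rho> - \<bar>u\<bar>) / 2 * inverse (real (Suc n))" for n
    have le: "\<bar>h n\<bar> \<le> (\<rho> - \<bar>u\<bar>) / 2 * 1" for n
      using that unfolding h_def abs_mult by (intro mult_mono) (auto simp: divide_simps)
    have "h n \<noteq> 0 \<and> \<bar>u + h n\<bar> < \<rho> \<and> \<bar>u - h n\<bar> < \<rho>" for n
    proof -
      have "\<bar>h n\<bar> < \<rho> - \<bar>u\<bar>"
        by (rule le_less_trans[OF le]) (use that in \<open>simp add: field_simps\<close>)
      then have "\<bar>u\<bar> + \<bar>h n\<bar> < \<rho>" by simp
      moreover have "h n \<noteq> 0" using that by (simp add: h_def)
      ultimately show ?thesis
        using abs_triangle_ineq[of u "h n"] abs_triangle_ineq4[of u "h n"] by auto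
    qed
    moreover have "h \<longlonglongrightarrow> 0"
      unfolding h_def by (rule tendsto_mult_right_zero[OF LIMSEQ_inverse_real_of_nat])
    ultimately show ?thesis by blast
  qed
  have at: "filterlim (\<lambda>n. complex_of_real (h n)) (at 0) sequentially"
    if "\<And>n. h n \<noteq> 0" "h \<longlonglongrightarrow> 0" for h
    using that tendsto_of_real[OF that(2)] by (auto simp: filterlim_at)
  have D_lim: "(\<lambda>n. D (h n) u x) \<longlonglongrightarrow> - (of_real (X x))\<^sup>2 * e u x"
    if "\<And>n. h n \<noteq> 0" "h \<longlonglongrightarrow> 0" for h u x
  proof -
    \<comment> \<open>For fixed \<open>x\<close> the exponential is entire in the frequency, so the
      pointwise limit is another instance of \<open>second_difference_tendsto\<close>.\<close>
    define g where "g z = exp (\<i> * z * of_real (X x))" for z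
    have g1: "deriv g = (\<lambda>z. \<i> * of_real (X x) * g z)"
      unfolding g_def by (rule ext, rule DERIV_imp_deriv) (auto intro!: derivative_eq_intros)
    have "deriv (deriv g) z = - (of_real (X x))\<^sup>2 * g z" for z
      unfolding g1 unfolding g_def
      by (rule DERIV_imp_deriv) (auto intro!: derivative_eq_intros simp: power2_eq_square algebra_simps)
    moreover have "g holomorphic_on UNIV" unfolding g_def by (intro holomorphic_intros)
    ultimately have "((\<lambda>h. (g (of_real u + h) + g (of_real u - h) - 2 * g (of_real u)) / h\<^sup>2)
        \<longlongrightarrow> - (of_real (X x))\<^sup>2 * g (of_real u)) (at 0)"
      using second_difference_tendsto[of g UNIV "of_real u"] by simp
    from filterlim_compose[OF this at[OF that]] show ?thesis
      by (simp add: D_def e_def g_def algebra_simps)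
  qed
  have D_int: "integrable M (\<lambda>x. of_real (w x) * D h u x)" (is ?A)
    and D_integral: "(\<integral>x. of_real (w x) * D h u x \<partial>M) =
      (f (of_real u + of_real h) + f (of_real u - of_real h) - 2 * f (of_real u)) / (of_real h)\<^sup>2" (is ?B)
    if "h \<noteq> 0" "\<bar>u\<bar> < \<rho>" "\<bar>u + h\<bar> < \<rho>" "\<bar>u - h\<bar> < \<rho>" for h u
  proof -
    have eq: "of_real (w x) * D h u x = (of_real (w x) * e (u + h) x + of_real (w x) * e (u - h) x
        - 2 * (of_real (w x) * e u x)) / (complex_of_real h)\<^sup>2" for x
      by (simp add: D_def algebra_simps)
    show ?A unfolding eq by (intro integrable_divide Bochner_Integration.integrable_diff
          Bochner_Integration.integrable_add integrable_mult_right int)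
    have "f (of_real v) = (\<integral>x. of_real (w x) * e v x \<partial>M)" if "\<bar>v\<bar> < \<rho>" for v
      using tr[OF that] by (simp add: e_def)
    from this[of u] this[of "u + h"] this[of "u - h"] that show ?B
      unfolding eq by (simp add: int)
  qed
  have f_lim: "(\<lambda>n. (f (of_real u + of_real (h n)) + f (of_real u - of_real (h n)) - 2 * f (of_real u))
      / (of_real (h n))\<^sup>2) \<longlonglongrightarrow> deriv (deriv f) (of_real u)"
    if "\<And>n. h n \<noteq> 0" "h \<longlonglongrightarrow> 0" "\<bar>u\<bar> < \<rho>" for h u
    by (rule filterlim_compose[OF second_difference_tendsto[OF f] at[OF that(1,2)]])
      (use that in auto)

  show I: "integrable M (\<lambda>x. w x * (X x)\<^sup>2)"
  proof (rule integrableI_bounded)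
    obtain h where h: "\<And>n. h n \<noteq> 0" "\<And>n. \<bar>h n\<bar> < \<rho>" "h \<longlonglongrightarrow> 0"
      using seq[of 0] \<rho> by auto
    \<comment> \<open>\<open>g n\<close> is nonnegative and, by \<open>D_0\<close>, is
      \<open>w * D\<close> at frequency 0 up to sign. So its integrals are computed from
      \<open>f\<close> and converge, while its pointwise limit is \<open>w * X^2\<close>.\<close>
    define g where "g n x = w x * norm (D (h n) 0 x)" for n x
    have g_int: "integrable M (g n)" for n
      using D_int[of "h n" 0, THEN integrable_norm] h(1,2)[of n] \<rho> w(2) unfolding g_def
      by (simp add: norm_mult)
    have g_eq: "integral\<^sup>L M (g n) = - Re (\<integral>x. of_real (w x) * D (h n) 0 x \<partial>M)" for n
    proof -
      have "of_real (w x) * D (h n) 0 x = of_real (- g n x)" for x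
        by (subst D_0) (simp_all add: g_def h)
      then show ?thesis by (simp add: integral_complex_of_real del: of_real_minus)
    qed
    have lim: "(\<lambda>n. integral\<^sup>L M (g n)) \<longlonglongrightarrow> - Re (deriv (deriv f) 0)"
      unfolding g_eq using D_integral[of "h _" 0] h \<rho> f_lim[of h 0]
      by (intro tendsto_minus tendsto_Re) auto
    have ptw: "(\<lambda>n. g n x) \<longlonglongrightarrow> w x * (X x)\<^sup>2" for x
      unfolding g_def using tendsto_norm[OF D_lim[OF h(1,3), where u = 0 and x = x]]
      by (intro tendsto_mult_left) (simp add: norm_mult norm_power)
    have "(\<integral>\<^sup>+x. norm (w x * (X x)\<^sup>2) \<partial>M) = (\<integral>\<^sup>+x. liminf (\<lambda>n. ennreal (g n x)) \<partial>M)"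
    proof (rule nn_integral_cong)
      fix x
      have "(\<lambda>n. ennreal (g n x)) \<longlonglongrightarrow> ennreal (w x * (X x)\<^sup>2)"
        using ptw by (intro tendsto_ennrealI)
      then show "ennreal (norm (w x * (X x)\<^sup>2)) = liminf (\<lambda>n. ennreal (g n x))"
        using w(2)[of x] by (simp add: lim_imp_Liminf)
    qed
    also have "\<dots> \<le> liminf (\<lambda>n. \<integral>\<^sup>+x. ennreal (g n x) \<partial>M)"
      using g_int by (intro nn_integral_liminf) auto
    also have "\<dots> = liminf (\<lambda>n. ennreal (integral\<^sup>L M (g n)))"
      using w(2) by (subst nn_integral_eq_integral[OF g_int]) (auto simp: g_def)
    also have "\<dots> = ennreal (- Re (deriv (deriv f) 0))"
      using lim by (intro lim_imp_Liminf tendsto_ennrealI) auto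
    also have "\<dots> < \<infinity>" by simp
    finally show "(\<integral>\<^sup>+x. norm (w x * (X x)\<^sup>2) \<partial>M) < \<infinity>" .
  qed auto

  fix u :: real assume u: "\<bar>u\<bar> < \<rho>"
  obtain h where h: "\<And>n. h n \<noteq> 0" "\<And>n. \<bar>u + h n\<bar> < \<rho>" "\<And>n. \<bar>u - h n\<bar> < \<rho>" "h \<longlonglongrightarrow> 0"
    using seq[OF u] by auto
  have "(\<lambda>n. \<integral>x. of_real (w x) * D (h n) u x \<partial>M) \<longlonglongrightarrow>
      (\<integral>x. of_real (w x) * (- (of_real (X x))\<^sup>2 * e u x) \<partial>M)"
  proof (rule integral_dominated_convergence[OF _ _ I])
    show "AE x in M. (\<lambda>n. of_real (w x) * D (h n) u x) \<longlonglongrightarrow>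
        of_real (w x) * (- (of_real (X x))\<^sup>2 * e u x)"
      using D_lim[OF h(1,4)] by (intro AE_I2 tendsto_mult_left) auto
    show "AE x in M. norm (of_real (w x) * D (h n) u x) \<le> w x * (X x)\<^sup>2" for n
      using D_le[OF h(1)] w(2) by (auto simp: norm_mult intro!: mult_left_mono)
  qed auto
  moreover have "(\<lambda>n. \<integral>x. of_real (w x) * D (h n) u x \<partial>M) \<longlonglongrightarrow> deriv (deriv f) (of_real u)"
    using f_lim[OF h(1,4) u] D_integral[OF h(1) u h(2,3)] by simp
  ultimately have "deriv (deriv f) (of_real u) =
      (\<integral>x. of_real (w x) * (- (of_real (X x))\<^sup>2 * e u x) \<partial>M)"
    by (rule LIMSEQ_unique[symmetric])
  then show "(\<integral>x. of_real (w x * (X x)\<^sup>2) * exp (\<i> * of_real (u * X x)) \<partial>M) =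
      - deriv (deriv f) (of_real u)"
    by (simp add: e_def mult.assoc)
qed

text \<open>One majorant \<open>G\<close> of the absolute series at radius \<open>t\<close>
  dominates every coefficient function, bounds the sum of their absolute integrals, and so permits
  termwise integration on the closed disc. The measure may be infinite, as needed for a Levy
  measure.\<close>

lemma sums_integral_power_series:
  fixes h :: "nat \<Rightarrow> 'a \<Rightarrow> real" and G :: "'a \<Rightarrow> real" and z :: complex
  assumes [measurable]: "\<And>n. h n \<in> borel_measurable M" and G: "integrable M G" and t: "t > 0"
    and s: "\<And>x. summable (\<lambda>n. \<bar>h n x\<bar> * t ^ n)" and le: "\<And>x. (\<Sum>n. \<bar>h n x\<bar> * t ^ n) \<le> G x"
  shows "integrable M (h n)"
    and "summable (\<lambda>n. \<bar>\<integral>x. h n x \<partial>M\<bar> * t ^ n)"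
    and "norm z \<le> t \<Longrightarrow> integrable M (\<lambda>x. \<Sum>n. of_real (h n x) * z ^ n)"
    and "norm z \<le> t \<Longrightarrow> (\<lambda>n. of_real (\<integral>x. h n x \<partial>M) * z ^ n) sums (\<integral>x. (\<Sum>n. of_real (h n x) * z ^ n) \<partial>M)"
proof -
  have part: "(\<Sum>n<N. \<bar>h n x\<bar> * t ^ n) \<le> G x" for N x
    using s le[of x] t by (meson order_trans sum_le_suminf finite_lessThan mult_nonneg_nonneg abs_ge_zero zero_le_power less_imp_le)
  have ht: "\<bar>h n x\<bar> * t ^ n \<le> G x" for n x
  proof -
    have "\<bar>h n x\<bar> * t ^ n \<le> (\<Sum>n<Suc n. \<bar>h n x\<bar> * t ^ n)"
      using t by (simp add: sum_nonneg)
    then show ?thesis using part[of x "Suc n"] by simp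
  qed
  have int: "integrable M (h n)" for n
  proof (rule Bochner_Integration.integrable_bound[of _ "\<lambda>x. G x / t ^ n"])
    have "\<bar>h n x\<bar> \<le> \<bar>G x / t ^ n\<bar>" for x
      using ht[of n x] t by (simp add: field_simps)
    then show "AE x in M. norm (h n x) \<le> norm (G x / t ^ n)" by simp
  qed (use G in auto)
  then show "integrable M (h n)" .
  have absum: "summable (\<lambda>n. (\<integral>x. \<bar>h n x\<bar> \<partial>M) * t ^ n)"
  proof (rule summableI_nonneg_bounded)
    fix N
    have "(\<Sum>n<N. (\<integral>x. \<bar>h n x\<bar> \<partial>M) * t ^ n) = (\<integral>x. (\<Sum>n<N. \<bar>h n x\<bar> * t ^ n) \<partial>M)"
      using int by (subst Bochner_Integration.integral_sum) auto
    also have "\<dots> \<le> integral\<^sup>L M G"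
      using int G part by (intro integral_mono) auto
    finally show "(\<Sum>n<N. (\<integral>x. \<bar>h n x\<bar> \<partial>M) * t ^ n) \<le> integral\<^sup>L M G" .
  qed (use t in auto)
  show "summable (\<lambda>n. \<bar>\<integral>x. h n x \<partial>M\<bar> * t ^ n)"
    by (rule summable_comparison_test'[OF absum, of 0])
      (use t in \<open>auto simp: abs_mult intro!: mult_right_mono integral_abs_bound\<close>)
  assume z: "norm z \<le> t"
  have zn: "norm z ^ n \<le> t ^ n" for n using z by (intro power_mono) auto
  have 1: "integrable M (\<lambda>x. of_real (h n x) * z ^ n)" for n using int by auto
  have 2: "AE x in M. summable (\<lambda>n. norm (of_real (h n x) * z ^ n))"
    by (intro AE_I2 summable_comparison_test'[OF s, of 0])
      (auto simp: norm_mult norm_power intro!: mult_left_mono zn)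
  have 3: "summable (\<lambda>n. \<integral>x. norm (of_real (h n x) * z ^ n) \<partial>M)"
    by (rule summable_comparison_test'[OF absum, of 0])
      (auto simp: norm_mult norm_power abs_mult intro!: mult_left_mono zn)
  show "integrable M (\<lambda>x. \<Sum>n. of_real (h n x) * z ^ n)"
    by (rule integrable_suminf[OF 1 2 3])
  show "(\<lambda>n. of_real (\<integral>x. h n x \<partial>M) * z ^ n) sums (\<integral>x. (\<Sum>n. of_real (h n x) * z ^ n) \<partial>M)"
    using sums_integral[OF 1 2 3] int by (simp add: integral_complex_of_real)
qed

text \<open>Even moments are derivatives of \<open>f\<close> at 0 up to sign, so the series for the
  integral of \<open>cosh (t * X)\<close> is dominated by the absolutely convergent Taylor series of
  \<open>f\<close> at \<open>t\<close>. Using \<open>cosh\<close> avoids odd moments, and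
  \<open>exp (t * |x|)\<close> is at most \<open>2 * cosh (t * x)\<close>.\<close>

lemma exponential_moment_of_holomorphic_transform:
  fixes X :: "'a \<Rightarrow> real" and f :: "complex \<Rightarrow> complex"
  assumes "finite_measure M" and X [measurable]: "X \<in> borel_measurable M"
    and f: "f holomorphic_on ball 0 \<rho>" and t: "0 < t" "t < \<rho>"
    and tr: "\<And>u. \<bar>u\<bar> < \<rho> \<Longrightarrow> (\<integral>x. exp (\<i> * of_real (u * X x)) \<partial>M) = f (of_real u)"
  shows "integrable M (\<lambda>x. exp (t * \<bar>X x\<bar>))"
proof -
  interpret finite_measure M by fact
  \<comment> \<open>Each induction step uses the weight \<open>X^(2k)\<close> and, as transform,
    \<open>(-1)^k\<close> times the derivative of order \<open>2k\<close>. The base case is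
    integrability of 1 over a finite measure.\<close>
  have moments: "integrable M (\<lambda>x. X x ^ (2 * k)) \<and> (\<forall>u. \<bar>u\<bar> < \<rho> \<longrightarrow>
      (\<integral>x. of_real (X x ^ (2 * k)) * exp (\<i> * of_real (u * X x)) \<partial>M)
        = (-1) ^ k * (deriv ^^ (2 * k)) f (of_real u))" for k
  proof (induction k)
    case (Suc k)
    let ?f = "\<lambda>z. (-1) ^ k * (deriv ^^ (2 * k)) f z"
    have hol: "(deriv ^^ n) f holomorphic_on ball 0 \<rho>" for n
      using f by (intro holomorphic_higher_deriv) auto
    have d1: "deriv ?f z = (-1) ^ k * deriv ((deriv ^^ (2 * k)) f) z" if "z \<in> ball 0 \<rho>" for z
      using hol[of "2 * k"] that by (intro deriv_cmult) (auto intro: holomorphic_on_imp_differentiable_at)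
    \<comment> \<open>Differentiating once more needs \<open>d1\<close> on a whole neighbourhood of
      \<open>z\<close>, which the open disc provides.\<close>
    have d2: "deriv (deriv ?f) z = (-1) ^ k * (deriv ^^ (2 * Suc k)) f z" if z: "z \<in> ball 0 \<rho>" for z
    proof -
      have "deriv (deriv ?f) z = deriv (\<lambda>z. (-1) ^ k * (deriv ^^ Suc (2 * k)) f z) z"
        using z d1 by (intro deriv_cong_ev) (auto simp: eventually_nhds intro!: exI[of _ "ball 0 \<rho>"])
      also have "\<dots> = (-1) ^ k * deriv ((deriv ^^ Suc (2 * k)) f) z"
        using hol[of "Suc (2 * k)"] z
        by (intro deriv_cmult) (auto intro: holomorphic_on_imp_differentiable_at)
      finally show ?thesis by simp
    qed
    have "?f holomorphic_on ball 0 \<rho>" by (intro holomorphic_intros hol)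
    note step = second_moment_of_holomorphic_transform[OF X, where w = "\<lambda>x. X x ^ (2 * k)", OF _ _ this]
    have tr': "(\<integral>x. of_real (X x ^ (2 * k)) * exp (\<i> * of_real (u * X x)) \<partial>M) = ?f (of_real u)"
      if "\<bar>u\<bar> < \<rho>" for u
      using Suc.IH that by blast
    have pow: "X x ^ (2 * k) * (X x)\<^sup>2 = X x ^ (2 * Suc k)" for x
      by (simp add: power2_eq_square)
    have "integrable M (\<lambda>x. X x ^ (2 * Suc k))"
      using step(1)[OF _ _ _ tr'] Suc.IH t unfolding pow by auto
    moreover have "(\<integral>x. of_real (X x ^ (2 * Suc k)) * exp (\<i> * of_real (u * X x)) \<partial>M)
        = (-1) ^ Suc k * (deriv ^^ (2 * Suc k)) f (of_real u)" if u: "\<bar>u\<bar> < \<rho>" for u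
      using step(2)[OF _ _ _ tr' u] Suc.IH t d2[of "of_real u"] u unfolding pow by auto
    ultimately show ?case by blast
  qed (use tr in auto)
  have mom0: "(\<integral>x. X x ^ (2 * k) \<partial>M) = Re ((-1) ^ k * (deriv ^^ (2 * k)) f 0)" for k
  proof -
    have "(\<integral>x. complex_of_real (X x ^ (2 * k)) \<partial>M) = (-1) ^ k * (deriv ^^ (2 * k)) f 0"
      using conjunct2[OF moments[of k], rule_format, of 0] t by simp
    then have "complex_of_real (\<integral>x. X x ^ (2 * k) \<partial>M) = (-1) ^ k * (deriv ^^ (2 * k)) f 0"
      unfolding integral_complex_of_real .
    then show ?thesis by (metis Re_complex_of_real)
  qed
  \<comment> \<open>The even part of the exponential series: its terms are nonnegative, so their
    integrals are also the integrals of their norms.\<close>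
  define c where "c n x = (if even n then (t * X x) ^ n / fact n else 0)" for n x
  have c_int: "integrable M (c n)" for n
    using moments[of "n div 2"]
    by (cases "even n") (auto simp: c_def[abs_def] power_mult_distrib)
  have c_nonneg: "0 \<le> c n x" for n x by (auto simp: c_def)
  have c_sums: "(\<lambda>n. c n x) sums cosh (t * X x)" for x
    using cosh_converges[of "t * X x"] by (simp add: c_def divide_inverse_commute cong: if_cong)
  have "summable (\<lambda>n. norm ((deriv ^^ n) f 0 / fact n * of_real t ^ n))"
  proof -
    \<comment> \<open>The midpoint lies in the disc but beyond \<open>t\<close>; convergence there
      forces absolute convergence at \<open>t\<close>.\<close>
    have "summable (\<lambda>n. (deriv ^^ n) f 0 / fact n * (of_real ((t + \<rho>) / 2) - 0) ^ n)"
      by (rule sums_summable[OF holomorphic_power_series[OF f]])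
        (unfold mem_ball dist_norm norm_of_real, use t in \<open>simp del: of_real_add of_real_divide\<close>)
    then have "summable (\<lambda>n. (deriv ^^ n) f 0 / fact n * of_real ((t + \<rho>) / 2) ^ n)"
      by simp
    then show ?thesis
      by (rule powser_insidea) (unfold norm_of_real, use t in simp)
  qed
  then have "summable (\<lambda>n. integral\<^sup>L M (c n))"
  proof (rule summable_comparison_test'[of _ 0])
    fix n :: nat
    show "norm (integral\<^sup>L M (c n)) \<le> norm ((deriv ^^ n) f 0 / fact n * of_real t ^ n)"
    proof (cases "even n")
      case True
      then have "integral\<^sup>L M (c n) = t ^ n * Re ((-1) ^ (n div 2) * (deriv ^^ n) f 0) / fact n"
        using mom0[of "n div 2"] by (simp add: c_def[abs_def] power_mult_distrib)
      also have "norm \<dots> \<le> t ^ n * norm ((-1) ^ (n div 2) * (deriv ^^ n) f 0) / fact n"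
        unfolding real_norm_def abs_mult abs_divide
        by (intro frac_le mult_mono abs_Re_le_cmod) (use t in auto)
      finally show ?thesis using t by (simp add: norm_mult norm_divide norm_power mult.commute)
    qed (simp add: c_def[abs_def])
  qed
  then have "integrable M (\<lambda>x. \<Sum>n. c n x)"
    using c_int c_nonneg sums_summable[OF c_sums] by (intro integrable_suminf) auto
  then have cosh_int: "integrable M (\<lambda>x. 2 * cosh (t * X x))"
    by (simp add: sums_unique[OF c_sums, symmetric])
  show ?thesis
  proof (rule Bochner_Integration.integrable_bound[OF cosh_int])
    have "exp (t * \<bar>y\<bar>) \<le> 2 * cosh (t * y)" for y
      by (cases "y \<ge> 0") (auto simp: cosh_field_def)
    then show "AE x in M. norm (exp (t * \<bar>X x\<bar>)) \<le> norm (2 * cosh (t * X x))"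
      by (auto intro: order_trans[OF _ abs_ge_self])
  qed auto
qed

section \<open>Weighted power series algebras\<close>

text \<open>The norm of \<open>PA r\<close> without the demand for real coefficients; its value is
  meaningful only together with \<open>wsummable\<close>.\<close>

definition wnorm :: "real \<Rightarrow> complex fps \<Rightarrow> real" where
  "wnorm r F = (\<Sum>n. norm (fps_nth F n) * r ^ n)"

definition wsummable :: "real \<Rightarrow> complex fps \<Rightarrow> bool" where
  "wsummable r F \<longleftrightarrow> summable (\<lambda>n. norm (fps_nth F n) * r ^ n)"

text \<open>The weight is multiplicative, \<open>r^n = r^i * r^(n - i)\<close>, so the weighted
  coefficients of the product are dominated by the Cauchy product of two absolutely convergent real
  series.\<close>

lemma wsummable_mult:
  assumes "r \<ge> 0" "wsummable r F" "wsummable r G"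
  shows "wsummable r (F * G)" and "wnorm r (F * G) \<le> wnorm r F * wnorm r G"
proof -
  let ?f = "\<lambda>n. norm (fps_nth F n) * r ^ n" and ?g = "\<lambda>n. norm (fps_nth G n) * r ^ n"
  have s: "summable (\<lambda>n. norm (?f n))" "summable (\<lambda>n. norm (?g n))"
    using assms by (simp_all add: wsummable_def abs_mult)
  have le: "norm (fps_nth (F * G) n) * r ^ n \<le> (\<Sum>i\<le>n. ?f i * ?g (n - i))" for n
  proof -
    have "norm (fps_nth (F * G) n) * r ^ n \<le>
        (\<Sum>i\<le>n. norm (fps_nth F i * fps_nth G (n - i))) * r ^ n"
      using assms(1) by (intro mult_right_mono) (auto simp: fps_mult_nth atLeast0AtMost intro!: norm_sum)
    also have "\<dots> = (\<Sum>i\<le>n. ?f i * ?g (n - i))"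
      unfolding sum_distrib_right
    proof (intro sum.cong refl)
      fix i assume "i \<in> {..n}"
      then have "r ^ n = r ^ i * r ^ (n - i)" by (simp flip: power_add)
      then show "norm (fps_nth F i * fps_nth G (n - i)) * r ^ n = ?f i * ?g (n - i)"
        by (simp only: norm_mult mult_ac)
    qed
    finally show ?thesis .
  qed
  show 1: "wsummable r (F * G)"
    unfolding wsummable_def
    by (rule summable_comparison_test'[OF summable_Cauchy_product[OF s], of 0])
      (use le assms(1) in \<open>auto simp: abs_mult\<close>)
  show "wnorm r (F * G) \<le> wnorm r F * wnorm r G"
    unfolding wnorm_def Cauchy_product[OF s]
    using 1 by (intro suminf_le le summable_Cauchy_product s) (simp add: wsummable_def)
qed

lemma wsummable_diff:
  assumes "r \<ge> 0" "wsummable r F" "wsummable r G"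
  shows "wsummable r (F - G)"
  unfolding wsummable_def
proof (rule summable_comparison_test'[of _ 0])
  show "summable (\<lambda>n. norm (fps_nth F n) * r ^ n + norm (fps_nth G n) * r ^ n)"
    using assms by (intro summable_add) (auto simp: wsummable_def)
  show "norm (norm (fps_nth (F - G) n) * r ^ n) \<le> norm (fps_nth F n) * r ^ n + norm (fps_nth G n) * r ^ n" for n
    using assms(1) by (auto simp: abs_mult norm_triangle_ineq4 intro!: mult_right_mono simp flip: distrib_right)
qed

lemma wnorm_nonneg: "r \<ge> 0 \<Longrightarrow> wsummable r F \<Longrightarrow> wnorm r F \<ge> 0"
  unfolding wnorm_def wsummable_def by (intro suminf_nonneg) auto

text \<open>Cauchy's inequality on the circle of radius \<open>t\<close> bounds the coefficients by
  \<open>B / t^n\<close>, and the weights \<open>r^n\<close> leave a geometric series of ratio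
  \<open>r / t\<close> with sum \<open>t / (t - r)\<close>. This converts supremum bounds on a
  larger circle into norm bounds.\<close>

lemma wnorm_le_sup:
  assumes g: "g holomorphic_on ball 0 \<rho>" and F: "g has_fps_expansion F"
    and r: "0 < r" "r < t" "t < \<rho>" and B: "\<And>z. norm z = t \<Longrightarrow> norm (g z) \<le> B"
  shows "wsummable r F" and "wnorm r F \<le> B * (t / (t - r))"
proof -
  have le: "norm (fps_nth F n) * r ^ n \<le> B * (r / t) ^ n" for n
  proof -
    have "norm ((deriv ^^ n) g 0) \<le> fact n * B / t ^ n"
    proof (rule Cauchy_inequality)
      show "g holomorphic_on ball 0 t" using g r by (auto intro: holomorphic_on_subset)
      show "continuous_on (cball 0 t) g"
        using g r by (intro holomorphic_on_imp_continuous_on) (auto intro: holomorphic_on_subset)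
    qed (use r B in auto)
    then have "norm (fps_nth F n) \<le> B / t ^ n"
      unfolding fps_nth_fps_expansion[OF F] by (simp add: norm_divide pos_divide_le_eq mult.commute)
    then have "norm (fps_nth F n) * r ^ n \<le> B / t ^ n * r ^ n"
      using r by (intro mult_right_mono) auto
    then show ?thesis by (simp add: power_divide)
  qed
  have geo: "(\<lambda>n. B * (r / t) ^ n) sums (B * (1 / (1 - r / t)))"
    using r by (intro sums_mult geometric_sums) auto
  show s: "wsummable r F"
    unfolding wsummable_def
    by (rule summable_comparison_test'[OF sums_summable[OF geo], of 0])
      (use le r in \<open>auto simp: abs_mult\<close>)
  have "wnorm r F \<le> B * (1 / (1 - r / t))"
    unfolding wnorm_def sums_unique[OF geo]
    using s geo by (intro suminf_le le) (auto simp: wsummable_def sums_iff)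
  then show "wnorm r F \<le> B * (t / (t - r))" using r by (simp add: field_simps)
qed

section \<open>The transform \<open>hPhi\<close> as an isometric algebra homomorphism\<close>

lemma inj_hPhi: "inj hPhi"
  by (auto simp: inj_def hPhi_def fps_eq_iff fun_eq_iff)

lemma norm_hPhi_nth: "norm (fps_nth (hPhi f) n) = \<bar>f n\<bar> / fact n"
  unfolding hPhi_def fps_nth_Abs_fps norm_of_real by (simp add: abs_mult power_abs)

lemma wnorm_hPhi: "wnorm r (hPhi f) = hnorm r f"
  by (simp add: wnorm_def hnorm_def norm_hPhi_nth)

lemma wsummable_hPhi: "wsummable r (hPhi f) \<longleftrightarrow> f \<in> HA r"
  by (simp add: wsummable_def HA_def norm_hPhi_nth)

lemma PA_iff: "F \<in> PA r \<longleftrightarrow> (\<forall>n. fps_nth F n \<in> \<real>) \<and> wsummable r F"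
  by (simp add: PA_def wsummable_def)

lemma hPhi_hunit: "hPhi hunit = 1"
  by (auto simp: fps_eq_iff hPhi_def hunit_def)

lemma hPhi_diff: "hPhi (\<lambda>n. f n - g n) = hPhi f - hPhi g"
  by (auto simp: fps_eq_iff hPhi_def diff_divide_distrib right_diff_distrib)

lemma hPhi_divide: "hPhi (\<lambda>n. f n / s) = fps_const (of_real (inverse s)) * hPhi f"
  by (auto simp: fps_eq_iff hPhi_def divide_inverse mult_ac)

text \<open>Dividing the binomial coefficient by \<open>fact n\<close> leaves
  \<open>1 / (fact i * fact (n - i))\<close>, and the sign splits accordingly: signed exponential
  generating functions turn binomial convolution into the Cauchy product.\<close>

lemma hPhi_hconv: "hPhi (hconv f g) = hPhi f * hPhi g"
proof (rule fps_ext)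
  fix n
  have "(-1) ^ n * hconv f g n / fact n =
      (\<Sum>i\<le>n. ((-1) ^ i * f i / fact i) * ((-1) ^ (n - i) * g (n - i) / fact (n - i)))"
    unfolding hconv_def sum_distrib_left sum_divide_distrib
  proof (intro sum.cong refl)
    fix i assume "i \<in> {..n}"
    then have i: "i \<le> n" by simp
    then have sign: "(-1) ^ n = (-1) ^ i * (-1 :: real) ^ (n - i)" by (simp flip: power_add)
    show "(-1) ^ n * (real (n choose i) * f i * g (n - i)) / fact n =
        (-1) ^ i * f i / fact i * ((-1) ^ (n - i) * g (n - i) / fact (n - i))"
      unfolding sign binomial_fact[OF i] by simp
  qed
  then show "fps_nth (hPhi (hconv f g)) n = fps_nth (hPhi f * hPhi g) n"
    unfolding hPhi_def fps_mult_nth fps_nth_Abs_fps atLeast0AtMost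
    by (simp only: of_real_sum of_real_mult)
qed

lemma PA_mult: "r \<ge> 0 \<Longrightarrow> F \<in> PA r \<Longrightarrow> G \<in> PA r \<Longrightarrow> F * G \<in> PA r"
  by (auto simp: PA_iff fps_mult_nth intro!: wsummable_mult sum_in_Reals Reals_mult)

text \<open>The probabilistic input is condensed into \<open>expansion\<close>; the semigroup law,
  continuity and generator then follow by complex analysis alone. \<open>E\<close> is \<eta> viewed
  as an element of the algebra.\<close>

locale exponential_semigroup =
  fixes \<eta> :: "complex \<Rightarrow> complex" and \<rho> r :: real and q :: "real \<Rightarrow> nat \<Rightarrow> real" and E :: "complex fps"
  assumes holo: "\<eta> holomorphic_on ball 0 \<rho>" and r: "0 < r" "r < \<rho>"
    and expansion: "\<And>s. s \<ge> 0 \<Longrightarrow> (\<lambda>z. exp (of_real s * \<eta> z)) has_fps_expansion hPhi (q s)"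
    and E: "\<eta> has_fps_expansion E" "E \<in> PA r"
begin

text \<open>The exponential is bounded on a circle of radius strictly between \<open>r\<close> and
  \<rho>, so \<open>wnorm_le_sup\<close> applies.\<close>

lemma in_HA: "s \<ge> 0 \<Longrightarrow> q s \<in> HA r"
proof -
  assume s: "s \<ge> 0"
  define t where "t = (r + \<rho>) / 2"
  have t: "r < t" "t < \<rho>" using r by (auto simp: t_def)
  have h: "(\<lambda>z. exp (of_real s * \<eta> z)) holomorphic_on ball 0 \<rho>" by (intro holomorphic_intros holo)
  have "compact ((\<lambda>z. exp (of_real s * \<eta> z)) ` cball 0 t)"
    using t by (intro compact_continuous_image holomorphic_on_imp_continuous_on holomorphic_on_subset[OF h]) auto
  then obtain B where "\<And>z. z \<in> cball 0 t \<Longrightarrow> norm (exp (of_real s * \<eta> z)) \<le> B"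
    by (metis bounded_iff compact_imp_bounded imageI)
  then show ?thesis
    unfolding wsummable_hPhi[symmetric] using r
    by (intro wnorm_le_sup(1)[OF h expansion[OF s] r(1) t]) auto
qed

text \<open>The functional equation of \<open>exp\<close> passes to coefficients by uniqueness of
  expansions and back to sequences by injectivity of \<open>hPhi\<close>.\<close>

lemma semigroup: "s \<ge> 0 \<Longrightarrow> u \<ge> 0 \<Longrightarrow> q (s + u) = hconv (q s) (q u)"
proof -
  assume "s \<ge> 0" "u \<ge> 0"
  then have "(\<lambda>z. exp (of_real s * \<eta> z) * exp (of_real u * \<eta> z)) has_fps_expansion hPhi (q s) * hPhi (q u)"
    "(\<lambda>z. exp (of_real (s + u) * \<eta> z)) has_fps_expansion hPhi (q (s + u))"
    by (intro has_fps_expansion_mult expansion; simp)+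
  then have "hPhi (q (s + u)) = hPhi (q s) * hPhi (q u)"
    using fps_expansion_unique_complex by (simp add: exp_add distrib_right)
  then show ?thesis using inj_hPhi by (simp add: hPhi_hconv[symmetric] inj_eq)
qed

lemma at_zero: "q 0 = hunit"
proof -
  have "hPhi (q 0) = 1"
    using expansion[of 0] by (intro fps_expansion_unique_complex[of "\<lambda>_. 1"]) auto
  then show ?thesis using inj_hPhi by (simp add: hPhi_hunit[symmetric] inj_eq)
qed

text \<open>The transformed difference quotient of the semigroup at 0, minus its expected limit
  \<open>E\<close>.\<close>

definition quot :: "real \<Rightarrow> complex fps" where
  "quot s = fps_const (of_real (inverse s)) * (hPhi (q s) - 1) - E"

lemma eta_bound:
  obtains t K where "r < t" "t < \<rho>" "0 \<le> K" "\<And>z. norm z = t \<Longrightarrow> norm (\<eta> z) \<le> K"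
proof -
  define t where "t = (r + \<rho>) / 2"
  have t: "r < t" "t < \<rho>" using r by (auto simp: t_def)
  have "compact (\<eta> ` cball 0 t)"
    using t by (intro compact_continuous_image holomorphic_on_imp_continuous_on holomorphic_on_subset[OF holo]) auto
  then obtain K where K: "\<And>z. z \<in> cball 0 t \<Longrightarrow> norm (\<eta> z) \<le> K"
    by (metis bounded_iff compact_imp_bounded imageI)
  have "0 \<le> K" using order_trans[OF norm_ge_zero K[of 0]] t r by simp
  with t K show thesis by (intro that[of t K]) auto
qed

text \<open>On the circle from \<open>eta_bound\<close> the second-order remainder of
  \<open>exp\<close> is \<open>O(s^2)\<close>; division by \<open>s\<close> leaves
  \<open>O(s)\<close>, which \<open>wnorm_le_sup\<close> carries over to radius
  \<open>r\<close>.\<close>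

lemma quot_bound: "\<exists>C. \<forall>s. 0 < s \<and> s \<le> 1 \<longrightarrow> wsummable r (quot s) \<and> wnorm r (quot s) \<le> C * s"
proof -
  obtain t K where t: "r < t" "t < \<rho>" and K0: "0 \<le> K" and K: "\<And>z. norm z = t \<Longrightarrow> norm (\<eta> z) \<le> K"
    by (rule eta_bound) auto
  let ?g = "\<lambda>s z. of_real (inverse s) * (exp (of_real s * \<eta> z) - 1) - \<eta> z"
  have main: "wsummable r (quot s) \<and> wnorm r (quot s) \<le> (exp K * K\<^sup>2 * s) * (t / (t - r))"
    if s: "0 < s" "s \<le> 1" for s
  proof -
    have hol: "?g s holomorphic_on ball 0 \<rho>" by (intro holomorphic_intros holo)
    have exp: "?g s has_fps_expansion quot s"
      unfolding quot_def using s by (intro has_fps_expansion_diff has_fps_expansion_mult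
          has_fps_expansion_const has_fps_expansion_1 expansion E) auto
    have "norm (?g s z) \<le> exp K * K\<^sup>2 * s" if "norm z = t" for z
    proof -
      let ?w = "of_real s * \<eta> z"
      have sK: "norm ?w \<le> s * K" using K[OF that] s by (auto simp: norm_mult intro!: mult_left_mono)
      \<comment> \<open>Here \<open>s <= 1\<close> enters: \<open>exp K\<close> replaces
        \<open>exp (s * K)\<close>, so the constant does not depend on \<open>s\<close>.\<close>
      have "s * K \<le> K" using mult_right_mono[of s 1 K] s K0 by simp
      then have "exp (norm ?w) * norm ?w ^ 2 \<le> exp K * (s * K)\<^sup>2"
        using sK by (intro mult_mono power_mono) auto
      then have 1: "norm (exp ?w - 1 - ?w) \<le> exp K * (s * K)\<^sup>2"
        using Taylor_exp_field[of ?w 1] by (simp add: power2_eq_square algebra_simps)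
      have "?g s z = (exp ?w - 1 - ?w) / of_real s" using s by (simp add: field_simps)
      then have "norm (?g s z) = norm (exp ?w - 1 - ?w) / s" using s by (simp add: norm_divide)
      also have "\<dots> \<le> exp K * (s * K)\<^sup>2 / s" using 1 s by (intro divide_right_mono) auto
      also have "\<dots> = exp K * K\<^sup>2 * s" using s by (simp add: power2_eq_square field_simps)
      finally show ?thesis .
    qed
    from wnorm_le_sup[OF hol exp r(1) t this] show ?thesis by blast
  qed
  show ?thesis
    by (intro exI[of _ "exp K * K\<^sup>2 * (t / (t - r))"]) (use main in \<open>auto simp: mult_ac\<close>)
qed

text \<open>Under \<open>hPhi\<close> the error of the difference quotient becomes
  \<open>hPhi f * quot s\<close>, so submultiplicativity and \<open>quot_bound\<close> give norm
  convergence for every \<open>f\<close>.\<close>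

lemma generator: "has_hgenerator r q (inv_into (HA r) hPhi \<circ> (\<lambda>F. E * F) \<circ> hPhi)"
  unfolding has_hgenerator_def
proof
  fix f assume f: "f \<in> HA r"
  then have fP: "hPhi f \<in> PA r" using hPhi_bij by (auto simp: bij_betw_def)
  define L where "L = (inv_into (HA r) hPhi \<circ> (\<lambda>F. E * F) \<circ> hPhi) f"
  \<comment> \<open>\<open>inv_into\<close> inverts \<open>hPhi\<close> only on the image of
    \<open>HA r\<close>; the product lands there because \<open>PA r\<close> is closed under
    multiplication.\<close>
  have EF: "E * hPhi f \<in> hPhi ` HA r"
    using hPhi_bij PA_mult[OF _ E(2) fP] r by (auto simp: bij_betw_def)
  have L: "L \<in> HA r" "hPhi L = E * hPhi f"
    using inv_into_into[OF EF] f_inv_into_f[OF EF] by (simp_all add: L_def)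
  define g where "g s n = (hconv f (q s) n - f n) / s" for s n
  have g: "hPhi (\<lambda>n. g s n - L n) = hPhi f * quot s" for s
  proof -
    have "hPhi (g s) = fps_const (of_real (inverse s)) * (hPhi f * hPhi (q s) - hPhi f)"
      unfolding g_def[abs_def] hPhi_divide hPhi_diff hPhi_hconv by (rule refl)
    then show ?thesis by (simp add: hPhi_diff L(2) quot_def algebra_simps)
  qed
  obtain C where C:
    "\<And>s. 0 < s \<Longrightarrow> s \<le> 1 \<Longrightarrow> wsummable r (quot s) \<and> wnorm r (quot s) \<le> C * s"
    using quot_bound by blast
  have wf: "wsummable r (hPhi f)" using f by (simp add: wsummable_hPhi)
  have small: "\<forall>\<^sub>F s :: real in at_right 0. 0 < s \<and> s \<le> 1"
    unfolding eventually_at_right_field by (auto intro!: exI[of _ 1])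
  have "hlim r g L (at_right 0)"
    unfolding hlim_def
  proof (intro conjI L)
    show "\<forall>\<^sub>F s in at_right 0. g s \<in> HA r"
      using small
    proof eventually_elim
      case (elim s)
      \<comment> \<open>Membership of the quotient follows by adding the limit back to the error,
        both being summable.\<close>
      have eq: "hPhi (g s) = hPhi f * quot s - (- (hPhi L))"
        using g[of s] by (simp add: hPhi_diff algebra_simps)
      have "wsummable r (- hPhi L)" using L(1) by (simp add: wsummable_def flip: wsummable_hPhi)
      then show ?case
        unfolding wsummable_hPhi[symmetric] eq using C[of s] elim wf r
        by (intro wsummable_diff wsummable_mult) auto
    qed
    have bound: "hnorm r (\<lambda>n. g s n - L n) \<le> wnorm r (hPhi f) * (C * s)"
      and nonneg: "0 \<le> hnorm r (\<lambda>n. g s n - L n)" if "0 < s \<and> s \<le> 1" for s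
    proof -
      have q: "wsummable r (quot s)" "wnorm r (quot s) \<le> C * s" using C[of s] that by auto
      have "hnorm r (\<lambda>n. g s n - L n) = wnorm r (hPhi f * quot s)"
        by (simp add: g flip: wnorm_hPhi)
      moreover have "wnorm r (hPhi f * quot s) \<le> wnorm r (hPhi f) * wnorm r (quot s)"
        using r wf q by (intro wsummable_mult) auto
      moreover have "\<dots> \<le> wnorm r (hPhi f) * (C * s)"
        using q wnorm_nonneg[OF _ wf] r by (intro mult_left_mono) auto
      ultimately show "hnorm r (\<lambda>n. g s n - L n) \<le> wnorm r (hPhi f) * (C * s)"
        "0 \<le> hnorm r (\<lambda>n. g s n - L n)"
        using wnorm_nonneg[of r "hPhi f * quot s"] wsummable_mult(1)[OF _ wf q(1)] r by auto
    qed
    show "((\<lambda>s. hnorm r (\<lambda>n. g s n - L n)) \<longlongrightarrow> 0) (at_right 0)"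
    proof (rule real_tendsto_sandwich)
      show "\<forall>\<^sub>F s in at_right 0. 0 \<le> hnorm r (\<lambda>n. g s n - L n)"
        using small nonneg by (rule eventually_mono)
      show "\<forall>\<^sub>F s in at_right 0. hnorm r (\<lambda>n. g s n - L n) \<le> wnorm r (hPhi f) * (C * s)"
        using small bound by (rule eventually_mono)
      show "((\<lambda>s. wnorm r (hPhi f) * (C * s)) \<longlongrightarrow> 0) (at_right 0)"
        by (rule tendsto_eq_rhs, (rule tendsto_intros)+) simp
    qed auto
  qed
  then show "hlim r (\<lambda>s n. (hconv f (q s) n - f n) / s)
      ((inv_into (HA r) hPhi \<circ> (\<lambda>F. E * F) \<circ> hPhi) f) (at_right 0)"
    by (simp add: g_def[abs_def] L_def)
qed

text \<open>The circle argument of \<open>quot_bound\<close> one order lower: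
  \<open>exp w - 1\<close> is bounded by \<open>exp |w| * |w|\<close>, so the distance to the unit
  is \<open>O(s)\<close>.\<close>

lemma tendsto_unit: "hlim r q hunit (at_right 0)"
  unfolding hlim_def
proof (intro conjI)
  show hu: "hunit \<in> HA r" using in_HA[of 0] by (simp add: at_zero)
  have small: "\<forall>\<^sub>F s :: real in at_right 0. 0 < s \<and> s \<le> 1"
    unfolding eventually_at_right_field by (auto intro!: exI[of _ 1])
  then show "\<forall>\<^sub>F s in at_right 0. q s \<in> HA r"
    by eventually_elim (simp add: in_HA)
  obtain t K where t: "r < t" "t < \<rho>" and K0: "0 \<le> K" and K: "\<And>z. norm z = t \<Longrightarrow> norm (\<eta> z) \<le> K"
    by (rule eta_bound) auto
  have bound: "hnorm r (\<lambda>n. q s n - hunit n) \<le> exp K * K * s * (t / (t - r))"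
    and nonneg: "0 \<le> hnorm r (\<lambda>n. q s n - hunit n)" if s: "0 < s \<and> s \<le> 1" for s
  proof -
    let ?g = "\<lambda>z. exp (of_real s * \<eta> z) - 1"
    have hol: "?g holomorphic_on ball 0 \<rho>" by (intro holomorphic_intros holo)
    have exp: "?g has_fps_expansion hPhi (q s) - 1"
      using s by (intro has_fps_expansion_diff has_fps_expansion_1 expansion) auto
    have "norm (?g z) \<le> exp K * K * s" if "norm z = t" for z
    proof -
      let ?w = "of_real s * \<eta> z"
      have sK: "norm ?w \<le> s * K" using K[OF that] s by (auto simp: norm_mult intro!: mult_left_mono)
      have "s * K \<le> K" using mult_right_mono[of s 1 K] s K0 by simp
      then have "exp (norm ?w) * norm ?w \<le> exp K * (s * K)"
        using sK by (intro mult_mono) auto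
      then show ?thesis using Taylor_exp_field[of ?w 0] by (simp add: mult_ac)
    qed
    note sup = wnorm_le_sup[OF hol exp r(1) t this]
    have eq: "hnorm r (\<lambda>n. q s n - hunit n) = wnorm r (hPhi (q s) - 1)"
      by (simp add: hPhi_diff hPhi_hunit flip: wnorm_hPhi)
    show "hnorm r (\<lambda>n. q s n - hunit n) \<le> exp K * K * s * (t / (t - r))"
      "0 \<le> hnorm r (\<lambda>n. q s n - hunit n)"
      unfolding eq using sup r by (auto intro: wnorm_nonneg)
  qed
  show "((\<lambda>s. hnorm r (\<lambda>n. q s n - hunit n)) \<longlongrightarrow> 0) (at_right 0)"
  proof (rule real_tendsto_sandwich)
    show "\<forall>\<^sub>F s in at_right 0. 0 \<le> hnorm r (\<lambda>n. q s n - hunit n)"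
      using small nonneg by (rule eventually_mono)
    show "\<forall>\<^sub>F s in at_right 0. hnorm r (\<lambda>n. q s n - hunit n) \<le> exp K * K * s * (t / (t - r))"
      using small bound by (rule eventually_mono)
    show "((\<lambda>s. exp K * K * s * (t / (t - r))) \<longlongrightarrow> 0) (at_right 0)"
      by (rule tendsto_eq_rhs, (rule tendsto_intros)+) simp
  qed auto
qed

lemma norm_continuous: "norm_continuous_hsemigroup r q"
  unfolding norm_continuous_hsemigroup_def using in_HA at_zero semigroup tendsto_unit by blast

end

section \<open>Laplace transforms of Levy processes\<close>

lemma sums_power_series_expansion:
  fixes f :: "complex \<Rightarrow> complex" and e :: "nat \<Rightarrow> complex"
  assumes \<rho>: "\<rho> > 0" and sums: "\<And>z. norm z < \<rho> \<Longrightarrow> (\<lambda>n. e n * z ^ n) sums f z"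
  shows "f holomorphic_on ball 0 \<rho>" and "f has_fps_expansion Abs_fps e"
proof -
  show "f holomorphic_on ball 0 \<rho>"
    by (rule power_series_holomorphic[of _ _ e]) (use sums in \<open>auto simp: dist_norm\<close>)
  have "\<forall>\<^sub>F z in nhds 0. z \<in> ball (0 :: complex) \<rho>"
    using \<rho> by (intro eventually_nhds_in_open) auto
  then show "f has_fps_expansion Abs_fps e"
    by (intro has_fps_expansionI) (auto elim!: eventually_mono intro!: sums)
qed

text \<open>One majorant justifies termwise integration: a multiple of \<open>x^2\<close> for small
  jumps, integrable for every Levy measure, and \<open>exp (\<rho> * |x|)\<close> for large jumps,
  integrable by hypothesis. Being taken at radius \<rho> itself, it covers the closed disc.\<close>

lemma levy_eta_power_series:
  assumes \<nu>: "levy_measure \<nu>" and \<rho>: "\<rho> > 0"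
    and exp: "(\<integral>\<^sup>+ x \<in> {x. \<bar>x\<bar> > 1}. ennreal (exp (\<rho> * \<bar>x\<bar>)) \<partial>\<nu>) < \<infinity>"
  obtains e :: "nat \<Rightarrow> real" where "summable (\<lambda>n. \<bar>e n\<bar> * \<rho> ^ n)"
    and "\<And>z. norm z \<le> \<rho> \<Longrightarrow> (\<lambda>n. of_real (e n) * z ^ n) sums levy_eta \<gamma> a \<nu> z"
proof -
  have sets [measurable_cong]: "sets \<nu> = sets borel" using \<nu> by (simp add: levy_measure_def)
  define I :: "real \<Rightarrow> real" where "I x = indicator {x. \<bar>x\<bar> \<le> 1} x" for x
  have [measurable]: "I \<in> borel_measurable borel" unfolding I_def[abs_def] by measurable
  \<comment> \<open>Taylor coefficients in \<open>z\<close> of the compensated integrand. The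
    constant term cancels everywhere, the linear one only where the truncation is active.\<close>
  define h where "h n x = (- x) ^ n / fact n -
      (if n = 0 then 1 else if n = 1 then - x * I x else 0)" for n and x :: real
  have [measurable]: "h n \<in> borel_measurable \<nu>" for n
    unfolding h_def[abs_def] by (cases "n = 0"; cases "n = 1") simp_all
  define G where "G x = (if \<bar>x\<bar> \<le> 1 then \<rho>\<^sup>2 * exp \<rho> * x\<^sup>2 else exp (\<rho> * \<bar>x\<bar>))" for x
  have [measurable]: "G \<in> borel_measurable \<nu>" unfolding G_def[abs_def] by measurable
  have G: "integrable \<nu> G"
  proof (rule integrableI_bounded)
    have "(\<integral>\<^sup>+x. ennreal (norm (G x)) \<partial>\<nu>) \<le>
        (\<integral>\<^sup>+x. ennreal (\<rho>\<^sup>2 * exp \<rho>) * ennreal (min 1 (x\<^sup>2)) +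
          ennreal (exp (\<rho> * \<bar>x\<bar>)) * indicator {x. \<bar>x\<bar> > 1} x \<partial>\<nu>)"
    proof (rule nn_integral_mono)
      fix x :: real
      have "x\<^sup>2 \<le> 1" if "\<bar>x\<bar> \<le> 1" using that by (simp add: abs_square_le_1)
      then show "ennreal (norm (G x)) \<le> ennreal (\<rho>\<^sup>2 * exp \<rho>) * ennreal (min 1 (x\<^sup>2)) +
          ennreal (exp (\<rho> * \<bar>x\<bar>)) * indicator {x. \<bar>x\<bar> > 1} x"
        by (cases "\<bar>x\<bar> \<le> 1") (auto simp: G_def abs_mult min_def simp flip: ennreal_mult)
    qed
    also have "\<dots> = ennreal (\<rho>\<^sup>2 * exp \<rho>) * (\<integral>\<^sup>+x. ennreal (min 1 (x\<^sup>2)) \<partial>\<nu>) +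
        (\<integral>\<^sup>+ x \<in> {x. \<bar>x\<bar> > 1}. ennreal (exp (\<rho> * \<bar>x\<bar>)) \<partial>\<nu>)"
      by (subst nn_integral_add) (auto simp: nn_integral_cmult)
    also have "\<dots> < \<infinity>"
      using \<nu> exp by (auto simp: levy_measure_def ennreal_mult_less_top)
    finally show "(\<integral>\<^sup>+x. ennreal (norm (G x)) \<partial>\<nu>) < \<infinity>" .
  qed auto
  \<comment> \<open>Stated over a general normed field because it serves both the real absolute
    series and the complex series.\<close>
  have corr: "(\<lambda>n. if n = 0 then 1 else if n = 1 then b else 0) sums (1 + b)"
    for b :: "'b :: real_normed_field"
    using sums_finite[of "{0, 1}" "\<lambda>n. if n = 0 then 1 else if n = 1 then b else 0"] by simp
  have abs_sums: "(\<lambda>n. \<bar>h n x\<bar> * \<rho> ^ n) sums (exp (\<rho> * \<bar>x\<bar>) - (1 + \<rho> * \<bar>x\<bar> * I x))" for x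
  proof -
    have "\<bar>h n x\<bar> * \<rho> ^ n = (\<rho> * \<bar>x\<bar>) ^ n /\<^sub>R fact n -
        (if n = 0 then 1 else if n = 1 then \<rho> * \<bar>x\<bar> * I x else 0)" for n
      by (auto simp: h_def I_def indicator_def abs_mult power_abs power_mult_distrib divide_inverse)
    then show ?thesis using sums_diff[OF exp_converges[of "\<rho> * \<bar>x\<bar>"] corr[of "\<rho> * \<bar>x\<bar> * I x"]]
      by simp
  qed
  have bound: "exp (\<rho> * \<bar>x\<bar>) - (1 + \<rho> * \<bar>x\<bar> * I x) \<le> G x" for x
  proof (cases "\<bar>x\<bar> \<le> 1")
    case True
    \<comment> \<open>For small jumps the sum is a second-order Taylor remainder, whence the factor
      \<open>x^2\<close> in \<open>G\<close>.\<close>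
    have "\<bar>exp (\<rho> * \<bar>x\<bar>) - (1 + \<rho> * \<bar>x\<bar>)\<bar> \<le> exp (\<rho> * \<bar>x\<bar>) * (\<rho> * \<bar>x\<bar>)\<^sup>2"
      using Taylor_exp_field[of "\<rho> * \<bar>x\<bar>" 1] \<rho> by (simp add: power2_eq_square)
    also have "\<dots> \<le> exp \<rho> * (\<rho> * \<bar>x\<bar>)\<^sup>2"
      using True \<rho> by (intro mult_right_mono) auto
    finally show ?thesis using True by (simp add: I_def G_def power_mult_distrib mult_ac)
  qed (simp add: I_def G_def)
  have z_sums: "(\<lambda>n. complex_of_real (h n x) * z ^ n) sums
      (exp (- z * of_real x) - 1 + z * of_real (x * I x))" for x z
  proof -
    have "complex_of_real (h n x) * z ^ n = (- z * of_real x) ^ n /\<^sub>R fact n -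
        (if n = 0 then 1 else if n = 1 then - z * of_real (x * I x) else 0)" for n
    proof -
      have "complex_of_real ((- x) ^ n / fact n) * z ^ n = (- z * of_real x) ^ n /\<^sub>R fact n"
        by (simp add: scaleR_conv_of_real divide_inverse flip: power_mult_distrib)
          (simp add: mult_ac flip: power_mult_distrib)
      then show ?thesis by (auto simp: h_def left_diff_distrib)
    qed
    moreover have "exp (- z * of_real x) - (1 + - z * of_real (x * I x)) =
        exp (- z * of_real x) - 1 + z * of_real (x * I x)" by simp
    ultimately show ?thesis
      using sums_diff[OF exp_converges[of "- z * of_real x"] corr[of "- z * of_real (x * I x)"]]
      by presburger
  qed
  note series = sums_integral_power_series[OF _ G \<rho>, of h, OF _ sums_summable[OF abs_sums]
      order.trans[OF eq_refl[OF sums_unique[OF abs_sums, symmetric]] bound]]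
  \<comment> \<open>The polynomial part of the exponent: drift in degree 1, Gaussian part in degree
    2.\<close>
  define d where "d n = (if n = 1 then - \<gamma> else if n = 2 then a / 2 else 0)" for n :: nat
  define e where "e n = (\<integral>x. h n x \<partial>\<nu>) + d n" for n
  have d_summable: "summable (\<lambda>n. \<bar>d n\<bar> * \<rho> ^ n)"
    by (rule summable_finite[of "{1, 2}"]) (auto simp: d_def)
  have d_sums: "(\<lambda>n. of_real (d n) * z ^ n) sums (- of_real \<gamma> * z + of_real (a / 2) * z\<^sup>2)" for z :: complex
  proof -
    have "(\<lambda>n. of_real (d n) * z ^ n) sums (\<Sum>n\<in>{1, 2}. of_real (d n) * z ^ n)"
      by (rule sums_finite) (auto simp: d_def)
    then show ?thesis by (simp add: d_def)
  qed
  show thesis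
  proof
    show "summable (\<lambda>n. \<bar>e n\<bar> * \<rho> ^ n)"
    proof (rule summable_comparison_test'[of _ 0])
      show "summable (\<lambda>n. \<bar>\<integral>x. h n x \<partial>\<nu>\<bar> * \<rho> ^ n + \<bar>d n\<bar> * \<rho> ^ n)"
        using series(2) d_summable by (intro summable_add) auto
      show "norm (\<bar>e n\<bar> * \<rho> ^ n) \<le> \<bar>\<integral>x. h n x \<partial>\<nu>\<bar> * \<rho> ^ n + \<bar>d n\<bar> * \<rho> ^ n" for n
        using \<rho> by (auto simp: e_def abs_mult intro!: mult_right_mono simp flip: distrib_right)
    qed
    fix z :: complex assume z: "norm z \<le> \<rho>"
    have "(\<lambda>n. of_real (\<integral>x. h n x \<partial>\<nu>) * z ^ n) sums
        (\<integral>x. (\<Sum>n. of_real (h n x) * z ^ n) \<partial>\<nu>)"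
      using z by (intro series(4)) auto
    then have "(\<lambda>n. of_real (\<integral>x. h n x \<partial>\<nu>) * z ^ n) sums
        (\<integral>x. (exp (- z * of_real x) - 1 + z * of_real (x * I x)) \<partial>\<nu>)"
      unfolding sums_unique[OF z_sums, symmetric] .
    from sums_add[OF d_sums this] show "(\<lambda>n. of_real (e n) * z ^ n) sums levy_eta \<gamma> a \<nu> z"
      by (simp add: levy_eta_def I_def e_def distrib_right add.commute)
  qed
qed

text \<open>The absolute series of \<open>exp (- z * X)\<close> at radius \<open>t\<close> sums
  exactly to \<open>exp (t * |X|)\<close>, the integrable majorant. The resulting coefficients are
  those of \<open>hPhi\<close> applied to the moments.\<close>

lemma laplace_transform_power_series:
  fixes X :: "'a \<Rightarrow> real" and z :: complex
  assumes X [measurable]: "X \<in> borel_measurable P" and t: "t > 0"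
    and int: "integrable P (\<lambda>\<omega>. exp (t * \<bar>X \<omega>\<bar>))"
  shows "integrable P (\<lambda>\<omega>. X \<omega> ^ n)"
    and "norm z \<le> t \<Longrightarrow> integrable P (\<lambda>\<omega>. exp (- z * of_real (X \<omega>)))"
    and "norm z \<le> t \<Longrightarrow>
      (\<lambda>n. of_real ((-1) ^ n * (\<integral>\<omega>. X \<omega> ^ n \<partial>P) / fact n) * z ^ n) sums
        (\<integral>\<omega>. exp (- z * of_real (X \<omega>)) \<partial>P)"
proof -
  define h where "h n \<omega> = (-1) ^ n * X \<omega> ^ n / fact n" for n \<omega>
  have [measurable]: "h n \<in> borel_measurable P" for n unfolding h_def[abs_def] by measurable
  have abs_sums: "(\<lambda>n. \<bar>h n \<omega>\<bar> * t ^ n) sums exp (t * \<bar>X \<omega>\<bar>)" for \<omega>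
    using exp_converges[of "t * \<bar>X \<omega>\<bar>"]
    by (simp add: h_def abs_mult power_abs power_mult_distrib divide_inverse mult_ac)
  have z_sums: "(\<lambda>n. complex_of_real (h n \<omega>) * z ^ n) sums exp (- z * of_real (X \<omega>))" for \<omega> z
  proof -
    have "complex_of_real (h n \<omega>) * z ^ n = (- z * of_real (X \<omega>)) ^ n /\<^sub>R fact n" for n
    proof -
      have "(- z * of_real (X \<omega>)) ^ n = (-1) ^ n * z ^ n * of_real (X \<omega>) ^ n"
        by (simp add: power_minus[of "z * of_real (X \<omega>)"] power_mult_distrib)
      then show ?thesis by (simp add: h_def scaleR_conv_of_real divide_inverse)
    qed
    then show ?thesis using exp_converges[of "- z * of_real (X \<omega>)"] by simp
  qed
  note series = sums_integral_power_series[OF _ int t, of h, OF _ sums_summable[OF abs_sums]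
      eq_refl[OF sums_unique[OF abs_sums, symmetric]]]
  show "integrable P (\<lambda>\<omega>. X \<omega> ^ n)"
    using integrable_mult_right[OF series(1)[of n], of "(-1) ^ n * fact n"]
    by (simp add: h_def flip: mult.assoc power_mult_distrib)
  have coeff: "(\<integral>\<omega>. h n \<omega> \<partial>P) = (-1) ^ n * (\<integral>\<omega>. X \<omega> ^ n \<partial>P) / fact n" for n
    by (simp add: h_def)
  assume z: "norm z \<le> t"
  have "integrable P (\<lambda>\<omega>. \<Sum>n. of_real (h n \<omega>) * z ^ n)"
    using z by (intro series(3)) auto
  then show "integrable P (\<lambda>\<omega>. exp (- z * of_real (X \<omega>)))"
    unfolding sums_unique[OF z_sums, symmetric] .
  have "(\<lambda>n. of_real (\<integral>\<omega>. h n \<omega> \<partial>P) * z ^ n) sums (\<integral>\<omega>. (\<Sum>n. of_real (h n \<omega>) * z ^ n) \<partial>P)"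
    using z by (intro series(4)) auto
  then show "(\<lambda>n. of_real ((-1) ^ n * (\<integral>\<omega>. X \<omega> ^ n \<partial>P) / fact n) * z ^ n) sums
        (\<integral>\<omega>. exp (- z * of_real (X \<omega>)) \<partial>P)"
    unfolding sums_unique[OF z_sums, symmetric] coeff .
qed

text \<open>This quarter turn reads the characteristic exponent as the values of
  \<open>levy_eta\<close> on the imaginary axis, which is how the triplet enters the
  argument.\<close>

lemma levy_eta_imaginary: "levy_eta \<gamma> a \<nu> (- \<i> * of_real u) = levy_symbol \<gamma> a \<nu> u"
proof -
  have 1: "- (- \<i> * complex_of_real u) * of_real x = \<i> * of_real (u * x)" for x by simp
  have 2: "- \<i> * complex_of_real u * of_real (x * y) = - (\<i> * of_real (u * x * y))" for x y by simp
  have 3: "- of_real \<gamma> * (- \<i> * complex_of_real u) = \<i> * of_real (\<gamma> * u)" by simp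
  have 4: "of_real (a / 2) * (- \<i> * complex_of_real u)\<^sup>2 = - of_real (a / 2 * u\<^sup>2)"
    by (simp add: power_mult_distrib)
  show ?thesis unfolding levy_eta_def levy_symbol_def 1 2 3 4 by (simp only: diff_conv_add_uminus)
qed

text \<open>The characteristic function is the restriction to real \<open>w\<close> of the
  holomorphic map \<open>exp (s * \<eta> (- \<i> * w))\<close>, which gives exponential moments and
  thus a holomorphic Laplace transform. It agrees with \<open>exp (s * \<eta>)\<close> on an
  imaginary segment, so the identity theorem extends the equality to the disc.\<close>

lemma laplace_transform_levy:
  fixes X :: "'a \<Rightarrow> real" and z :: complex
  assumes P: "prob_space P" and X [measurable]: "X \<in> borel_measurable P"
    and char: "\<And>u. (\<integral>\<omega>. exp (\<i> * of_real (u * X \<omega>)) \<partial>P) = exp (of_real s * \<eta> (- \<i> * of_real u))"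
    and \<eta>: "\<eta> holomorphic_on ball 0 \<rho>" and t: "0 < t" "t < \<rho>"
  shows "integrable P (\<lambda>\<omega>. exp (t * \<bar>X \<omega>\<bar>))"
    and "norm z < t \<Longrightarrow> (\<integral>\<omega>. exp (- z * of_real (X \<omega>)) \<partial>P) = exp (of_real s * \<eta> z)"
proof -
  interpret prob_space P by fact
  have "(\<lambda>w. exp (of_real s * \<eta> (- \<i> * w))) holomorphic_on ball 0 \<rho>"
    by (intro holomorphic_intros holomorphic_on_compose_gen[OF _ \<eta>, unfolded o_def, of "\<lambda>w. - \<i> * w"])
      (auto simp: norm_mult)
  from exponential_moment_of_holomorphic_transform[OF finite_measure_axioms X this t] char
  show int: "integrable P (\<lambda>\<omega>. exp (t * \<bar>X \<omega>\<bar>))" by simp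
  let ?L = "\<lambda>z. \<integral>\<omega>. exp (- z * of_real (X \<omega>)) \<partial>P"
  have L: "?L holomorphic_on ball 0 t"
    by (rule sums_power_series_expansion(1)[OF t(1)])
      (rule laplace_transform_power_series(3)[OF X t(1) int less_imp_le])
  \<comment> \<open>A segment ending at 0 suffices, since the identity theorem only needs a limit
    point inside the disc.\<close>
  define U where "U = (\<lambda>u. - \<i> * complex_of_real u) ` {0<..<t}"
  assume z: "norm z < t"
  have "?L z - exp (of_real s * \<eta> z) = 0"
  proof (rule analytic_continuation[of "\<lambda>z. ?L z - exp (of_real s * \<eta> z)" "ball 0 t" U 0 z])
    show "(\<lambda>z. ?L z - exp (of_real s * \<eta> z)) holomorphic_on ball 0 t"
      by (intro holomorphic_intros L holomorphic_on_subset[OF \<eta>]) (use t in auto)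
    show "?L z - exp (of_real s * \<eta> z) = 0" if zU: "z \<in> U" for z
    proof -
      obtain u :: real where "z = - \<i> * of_real u" using zU by (auto simp: U_def)
      then show ?thesis using char[of u] by (simp add: mult.assoc)
    qed
    show "0 islimpt U"
      unfolding islimpt_approachable
    proof (intro allI impI)
      fix d :: real assume "d > 0"
      then have *: "0 < min d t / 2" "min d t / 2 < d" "min d t / 2 < t" using t by auto
      then have "norm (- \<i> * complex_of_real (min d t / 2)) < d"
        unfolding norm_mult norm_of_real by simp
      with * show "\<exists>x'\<in>U. x' \<noteq> 0 \<and> dist x' 0 < d"
        unfolding U_def dist_norm
        by (intro bexI[of _ "- \<i> * complex_of_real (min d t / 2)"] imageI) simp_all
    qed
  qed (use t z in \<open>auto simp: U_def norm_mult\<close>)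
  then show "?L z = exp (of_real s * \<eta> z)" by simp
qed

section \<open>Specialization to the moment series of a Levy process\<close>

theorem theorem5p9:
  fixes P :: "'a measure" and X :: "real \<Rightarrow> 'a \<Rightarrow> real"
    and \<gamma> a \<rho> r :: real and \<nu> :: "real measure"
  assumes "levy_process P X"
    and "characteristic_triplet P X \<gamma> a \<nu>"
    and "\<rho> > 0"
    and "(\<integral>\<^sup>+ x \<in> {x. \<bar>x\<bar> > 1}. ennreal (exp (\<rho> * \<bar>x\<bar>)) \<partial>\<nu>) < \<infinity>"
    and "0 < r" and "r < \<rho>"
  shows "(\<forall>s\<ge>0. \<forall>n. integrable P (\<lambda>\<omega>. X s \<omega> ^ n)) \<and>
    norm_continuous_hsemigroup r (moment_series P X) \<and>
    fps_expansion (levy_eta \<gamma> a \<nu>) 0 \<in> PA r \<and>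
    (\<forall>z. norm z \<le> r \<longrightarrow> eval_fps (fps_expansion (levy_eta \<gamma> a \<nu>) 0) z = levy_eta \<gamma> a \<nu> z) \<and>
    has_hgenerator r (moment_series P X)
      (inv_into (HA r) hPhi \<circ> (\<lambda>F. fps_expansion (levy_eta \<gamma> a \<nu>) 0 * F) \<circ> hPhi) \<and>
    (\<forall>s\<ge>0. \<forall>z. norm z \<le> r \<longrightarrow>
       integrable P (\<lambda>\<omega>. exp (- z * of_real (X s \<omega>))) \<and>
       eval_fps (hPhi (moment_series P X s)) z =
         prob_space.expectation P (\<lambda>\<omega>. exp (- z * of_real (X s \<omega>))) \<and>
       prob_space.expectation P (\<lambda>\<omega>. exp (- z * of_real (X s \<omega>))) =
         exp (of_real s * levy_eta \<gamma> a \<nu> z))"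
proof -
  have P: "prob_space P" and X: "\<And>s. s \<ge> 0 \<Longrightarrow> X s \<in> borel_measurable P"
    using assms(1) by (auto simp: levy_process_def)
  have \<nu>: "levy_measure \<nu>"
    and char: "\<And>s u. s \<ge> 0 \<Longrightarrow> (\<integral>\<omega>. exp (\<i> * of_real (u * X s \<omega>)) \<partial>P) =
      exp (of_real s * levy_eta \<gamma> a \<nu> (- \<i> * of_real u))"
    using assms(2) unfolding characteristic_triplet_def levy_eta_imaginary by auto
  let ?\<eta> = "levy_eta \<gamma> a \<nu>" and ?q = "moment_series P X"
  obtain e :: "nat \<Rightarrow> real" where e_summable: "summable (\<lambda>n. \<bar>e n\<bar> * \<rho> ^ n)"
    and e_sums: "\<And>z. norm z \<le> \<rho> \<Longrightarrow> (\<lambda>n. of_real (e n) * z ^ n) sums ?\<eta> z"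
    by (rule levy_eta_power_series[OF \<nu> assms(3,4)]) blast
  note \<eta> = sums_power_series_expansion[OF \<open>\<rho> > 0\<close> e_sums[OF less_imp_le]]
  define E where "E = Abs_fps (\<lambda>n. complex_of_real (e n))"
  have E_eq: "fps_expansion ?\<eta> 0 = E" unfolding E_def by (rule fps_expansion_eqI[OF \<eta>(2)])
  have E_PA: "E \<in> PA r"
  proof -
    have "summable (\<lambda>n. \<bar>e n\<bar> * r ^ n)"
      by (rule summable_comparison_test'[OF e_summable, of 0])
        (use assms(5,6) in \<open>auto simp: abs_mult intro!: mult_left_mono power_mono\<close>)
    then show ?thesis by (simp add: PA_def E_def)
  qed
  have E_eval: "eval_fps E z = ?\<eta> z" if "norm z \<le> r" for z
    using sums_unique[OF e_sums[of z]] that assms(6) by (simp add: eval_fps_def E_def)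
  \<comment> \<open>The Laplace identity is available only on the open disc of radius
    \<open>t\<close>; taking \<open>r < t\<close> covers the closed disc of radius \<open>r\<close>,
    and \<open>t < \<rho>\<close> keeps the exponential moment finite.\<close>
  define t where "t = (r + \<rho>) / 2"
  have t: "0 < t" "r < t" "t < \<rho>" using assms(5,6) by (auto simp: t_def)
  have int: "integrable P (\<lambda>\<omega>. exp (t * \<bar>X s \<omega>\<bar>))" if "s \<ge> 0" for s
    by (rule laplace_transform_levy(1)[OF P X[OF that] char[OF that] \<eta>(1) t(1,3)])
  have laplace: "(\<integral>\<omega>. exp (- z * of_real (X s \<omega>)) \<partial>P) = exp (of_real s * ?\<eta> z)"
    if "s \<ge> 0" "norm z < t" for s z
    by (rule laplace_transform_levy(2)[OF P X[OF that(1)] char[OF that(1)] \<eta>(1) t(1,3) that(2)])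
  note moments = laplace_transform_power_series[OF X t(1) int]
  have hPhi_sums: "(\<lambda>n. fps_nth (hPhi (?q s)) n * z ^ n) sums (\<integral>\<omega>. exp (- z * of_real (X s \<omega>)) \<partial>P)"
    if "s \<ge> 0" "norm z \<le> t" for s z
    using moments(3)[OF that(1) that(1) that(2)]
    by (simp add: hPhi_def moment_series_def)
  interpret exponential_semigroup ?\<eta> \<rho> r ?q E
  proof
    fix s :: real assume s: "s \<ge> 0"
    have "(\<lambda>n. fps_nth (hPhi (?q s)) n * z ^ n) sums exp (of_real s * ?\<eta> z)" if "norm z < t" for z
      using hPhi_sums[OF s less_imp_le[OF that]] laplace[OF s that] by simp
    from sums_power_series_expansion(2)[OF t(1) this]
    show "(\<lambda>z. exp (of_real s * ?\<eta> z)) has_fps_expansion hPhi (?q s)"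
      by (simp add: fps_nth_inverse)
  qed (use \<eta> assms(5,6) E_PA in \<open>auto simp: E_def\<close>)
  have "integrable P (\<lambda>\<omega>. exp (- z * of_real (X s \<omega>)))"
    "eval_fps (hPhi (?q s)) z = (\<integral>\<omega>. exp (- z * of_real (X s \<omega>)) \<partial>P)"
    "(\<integral>\<omega>. exp (- z * of_real (X s \<omega>)) \<partial>P) = exp (of_real s * ?\<eta> z)"
    if "s \<ge> 0" "norm z \<le> r" for s z
    using moments(2)[of s z] sums_unique[OF hPhi_sums[of s z]] laplace[of s z] that t
    by (auto simp: eval_fps_def)
  moreover have "integrable P (\<lambda>\<omega>. X s \<omega> ^ n)" if "s \<ge> 0" for s n
    using moments(1) that by blast
  ultimately show ?thesis
    unfolding E_eq using norm_continuous generator E_PA E_eval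
    by (intro conjI allI impI) (simp_all only:)
qed

end
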